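(* Let $G$ and $H$ be simple connected graphs, each with at least two vertices. Then the Kronecker product $G \otimes H$ is not isomorphic to the strong product $G \boxtimes H$.
   Context: All graphs are finite, undirected and simple (no loops or multiple edges). For graphs $G$ and $H$, the following products have vertex set $V(G)\times V(H)$. The Kronecker (direct) product $G\otimes H$: $(x,y)\sim(x',y')$ if $x\sim x'$ in $G$ and $y\sim y'$ in $H$. The strong product $G\boxtimes H$: $(x,y)\sim(x',y')$ if either ($x\sim x'$ in $G$ and $y=y'$) or ($x=x'$ and $y\sim y'$ in $H$) or ($x\sim x'$ in $G$ and $y\sim y'$ in $H$). Two graphs are isomorphic if there is a bijection between their vertex sets that preserves adjacency and non-adjacency. *)

theory Defs
  imports "Graph_Theory.Pair_Digraph" "Graph_Theory.Digraph_Component"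
    "Graph_Theory.Digraph_Isomorphism"
begin

text \<open>
  A finite simple undirected graph is a \<^locale>\<open>pair_graph\<close>: each edge between
  \<open>x\<close> and \<open>y\<close> is represented by the two arcs \<open>(x, y)\<close> and \<open>(y, x)\<close>, so adjacency is
  membership in \<^const>\<open>parcs\<close>.
\<close>

definition kronecker_product ::
  "'a pair_pre_digraph \<Rightarrow> 'b pair_pre_digraph \<Rightarrow> ('a \<times> 'b) pair_pre_digraph" where
  "kronecker_product G H =
    \<lparr> pverts = pverts G \<times> pverts H,
      parcs = {((x, y), (x', y')) | x y x' y'. (x, x') \<in> parcs G \<and> (y, y') \<in> parcs H} \<rparr>"

text \<open>
  Equal coordinates must be required to be vertices explicitly, since the types \<open>'a\<close> and \<open>'b\<close>
  may contain elements that are not vertices.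
\<close>

definition strong_product ::
  "'a pair_pre_digraph \<Rightarrow> 'b pair_pre_digraph \<Rightarrow> ('a \<times> 'b) pair_pre_digraph" where
  "strong_product G H =
    \<lparr> pverts = pverts G \<times> pverts H,
      parcs = {((x, y), (x', y')) | x y x' y'.
          ((x, x') \<in> parcs G \<and> y = y' \<and> y \<in> pverts H)
        \<or> (x = x' \<and> x \<in> pverts G \<and> (y, y') \<in> parcs H)
        \<or> ((x, x') \<in> parcs G \<and> (y, y') \<in> parcs H)} \<rparr>"

lemma pair_graph_kronecker_product:
  assumes "pair_graph G" "pair_graph H"
  shows "pair_graph (kronecker_product G H)"
proof -
  interpret G: pair_graph G by fact
  interpret H: pair_graph H by fact
  let ?P = "kronecker_product G H"
  have sub: "parcs ?P \<subseteq> pverts ?P \<times> pverts ?P"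
    by (auto simp: kronecker_product_def dest: G.wellformed' H.wellformed')
  have fin: "finite (pverts ?P)"
    by (simp add: kronecker_product_def G.pair_finite_verts H.pair_finite_verts)
  show ?thesis
  proof
    show "finite (parcs ?P)" using sub fin by (meson finite_SigmaI finite_subset)
    show "symmetric (with_proj ?P)"
      by (auto simp: symmetric_def sym_def kronecker_product_def
          intro: G.arcs_symmetric H.arcs_symmetric)
    show "fst e \<noteq> snd e" if "e \<in> parcs ?P" for e
      using that by (auto simp: kronecker_product_def dest: G.no_loops' H.no_loops')
  qed (use sub fin in auto)
qed

lemma pair_graph_strong_product:
  assumes "pair_graph G" "pair_graph H"
  shows "pair_graph (strong_product G H)"
proof -
  interpret G: pair_graph G by fact
  interpret H: pair_graph H by fact
  let ?P = "strong_product G H"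
  have sub: "parcs ?P \<subseteq> pverts ?P \<times> pverts ?P"
    by (auto simp: strong_product_def dest: G.wellformed' H.wellformed')
  have fin: "finite (pverts ?P)"
    by (simp add: strong_product_def G.pair_finite_verts H.pair_finite_verts)
  show ?thesis
  proof
    show "finite (parcs ?P)" using sub fin by (meson finite_SigmaI finite_subset)
    show "symmetric (with_proj ?P)"
      by (auto simp: symmetric_def sym_def strong_product_def
          intro: G.arcs_symmetric H.arcs_symmetric)
    show "fst e \<noteq> snd e" if "e \<in> parcs ?P" for e
      using that by (auto simp: strong_product_def dest: G.no_loops' H.no_loops')
  qed (use sub fin in auto)
qed

text \<open>
  For these graphs \<^const>\<open>digraph_iso\<close> is isomorphism in the usual sense: an isomorphism of
  digraphs also carries a map on arcs, but that map is determined by the one on vertices.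
\<close>

lemma digraph_iso_with_proj_iff:
  assumes "pair_graph G" "pair_graph H"
  shows "digraph_iso (with_proj G) (with_proj H) \<longleftrightarrow>
    (\<exists>f. bij_betw f (pverts G) (pverts H) \<and>
      (\<forall>u \<in> pverts G. \<forall>v \<in> pverts G. (u, v) \<in> parcs G \<longleftrightarrow> (f u, f v) \<in> parcs H))"
    (is "?L \<longleftrightarrow> ?R")
proof
  interpret G: pair_graph G by fact
  interpret H: pair_graph H by fact
  {
    assume ?L
    then obtain h where iso: "pre_digraph.digraph_isomorphism (with_proj G) h"
      and eq: "with_proj H = app_iso h (with_proj G)"
      by (auto simp: digraph_iso_def)
    let ?f = "iso_verts h"
    from eq have V: "pverts H = ?f ` pverts G" and A: "parcs H = iso_arcs h ` parcs G"
      and t: "iso_tail h = fst" and hd: "iso_head h = snd"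
      by (auto simp: with_proj_def app_iso_def)
    have inj: "inj_on ?f (pverts G)"
      using iso by (simp add: pre_digraph.digraph_isomorphism_def)
    have arc: "iso_arcs h (u, v) = (?f u, ?f v)" if "(u, v) \<in> parcs G" for u v
      using iso that by (force simp: pre_digraph.digraph_isomorphism_def t hd prod_eq_iff)
    have "(u, v) \<in> parcs G \<longleftrightarrow> (?f u, ?f v) \<in> parcs H"
      if uv: "u \<in> pverts G" "v \<in> pverts G" for u v
    proof
      assume "(u, v) \<in> parcs G" then show "(?f u, ?f v) \<in> parcs H"
        using arc A by (metis imageI)
    next
      assume "(?f u, ?f v) \<in> parcs H"
      then obtain a b where ab: "(a, b) \<in> parcs G" "iso_arcs h (a, b) = (?f u, ?f v)"
        using A by force
      then have "?f a = ?f u" "?f b = ?f v" "a \<in> pverts G" "b \<in> pverts G"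
        using arc by (auto dest: G.wellformed')
      then show "(u, v) \<in> parcs G" using ab(1) uv inj by (metis inj_onD)
    qed
    then show ?R using inj V by (auto simp: bij_betw_def)
  next
    assume ?R
    then obtain f where bij: "bij_betw f (pverts G) (pverts H)"
      and adj: "\<And>u v. u \<in> pverts G \<Longrightarrow> v \<in> pverts G \<Longrightarrow>
        (u, v) \<in> parcs G \<longleftrightarrow> (f u, f v) \<in> parcs H"
      by blast
    let ?h = "\<lparr> iso_verts = f, iso_arcs = map_prod f f, iso_head = snd, iso_tail = fst \<rparr>"
    have inj: "inj_on f (pverts G)" and V: "pverts H = f ` pverts G"
      using bij by (auto simp: bij_betw_def)
    have sub: "parcs G \<subseteq> pverts G \<times> pverts G" by (auto dest: G.wellformed')
    have "inj_on (map_prod f f) (parcs G)"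
      using inj_on_subset[OF map_prod_inj_on[OF inj inj] sub] .
    then have iso: "pre_digraph.digraph_isomorphism (with_proj G) ?h"
      using inj by (auto simp: pre_digraph.digraph_isomorphism_def intro: G.wf_digraph)
    have "parcs H = map_prod f f ` parcs G"
    proof
      show "parcs H \<subseteq> map_prod f f ` parcs G"
      proof
        fix e assume e: "e \<in> parcs H"
        then have "fst e \<in> f ` pverts G" "snd e \<in> f ` pverts G"
          using V H.arc_fst_in_verts H.arc_snd_in_verts by auto
        then obtain u v where "u \<in> pverts G" "v \<in> pverts G" "e = (f u, f v)"
          by (metis imageE prod.collapse)
        then show "e \<in> map_prod f f ` parcs G" using e adj by force
      qed
      show "map_prod f f ` parcs G \<subseteq> parcs H" using adj sub by auto
    qed
    then have "with_proj H = app_iso ?h (with_proj G)"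
      using V by (simp add: with_proj_def app_iso_def)
    with iso show ?L by (auto simp: digraph_iso_def)
  }
qed

end

theory Submission
  imports Defs
begin

text \<open>
  On the common vertex set, every arc of the Kronecker product is an arc of the strong product, and
  an arc of the first factor paired with a fixed vertex of the second is an additional one. So the
  strong product has strictly more arcs, whereas isomorphic digraphs have equally many.
\<close>

text \<open>The arc component of an isomorphism is injective on the arcs of \<open>G\<close>, and
  its image is the arc set of \<open>H\<close>.\<close>

lemma digraph_iso_card_arcs:
  assumes "digraph_iso G H"
  shows "card (arcs G) = card (arcs H)"
  using assms
  by (auto simp: digraph_iso_def pre_digraph.digraph_isomorphism_def app_iso_def card_image)

lemma connected_imp_arcs_nonempty:
  assumes "Digraph_Component.connected (with_proj G)" and "card (pverts G) \<ge> 2"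
  shows "parcs G \<noteq> {}"
proof
  assume empty: "parcs G = {}"
  obtain u v where "u \<in> pverts G" "v \<in> pverts G" "u \<noteq> v"
    using assms(2) by (metis card_2_iff' obtain_subset_with_card_n subsetD)
  \<comment> \<open>Connectedness is strong connectedness of the symmetric closure. With no arcs in
    \<open>G\<close> the closure has none either, so reachability would force
    \<open>u = v\<close>.\<close>
  moreover from this have "u \<rightarrow>\<^sup>*\<^bsub>with_proj (mk_symmetric (with_proj G))\<^esub> v"
    using assms(1) by (simp add: connected_def strongly_connected_def)
  ultimately show False
    using empty by (auto simp: reachable_def mk_symmetric_def elim: rtrancl_on.cases)
qed

lemma kronecker_product_arcs_psubset_strong_product:
  assumes "parcs G \<noteq> {}" and "\<And>e. e \<in> parcs H \<Longrightarrow> fst e \<noteq> snd e" and "pverts H \<noteq> {}"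
  shows "parcs (kronecker_product G H) \<subset> parcs (strong_product G H)"
proof -
  obtain x x' y where "(x, x') \<in> parcs G" "y \<in> pverts H"
    using assms(1,3) by auto
  \<comment> \<open>In the Kronecker product this arc would require the loop \<open>(y, y)\<close>
    in \<open>H\<close>.\<close>
  then have "((x, y), (x', y)) \<in> parcs (strong_product G H) - parcs (kronecker_product G H)"
    using assms(2)[of "(y, y)"] by (auto simp: kronecker_product_def strong_product_def)
  moreover have "parcs (kronecker_product G H) \<subseteq> parcs (strong_product G H)"
    by (auto simp: kronecker_product_def strong_product_def)
  ultimately show ?thesis by blast
qed

theorem theorem3p6:
  fixes G :: "'a pair_pre_digraph" and H :: "'b pair_pre_digraph"
  assumes "pair_graph G" and "pair_graph H"
    and "Digraph_Component.connected (with_proj G)"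
    and "Digraph_Component.connected (with_proj H)"
    and "card (pverts G) \<ge> 2" and "card (pverts H) \<ge> 2"
  shows "\<not> digraph_iso (with_proj (kronecker_product G H)) (with_proj (strong_product G H))"
proof
  interpret H: pair_graph H by fact
  \<comment> \<open>This supplies finiteness of the larger arc set, without which strict inclusion
    would not give a strictly smaller cardinality.\<close>
  interpret S: pair_graph "strong_product G H"
    using assms(1,2) by (rule pair_graph_strong_product)
  assume "digraph_iso (with_proj (kronecker_product G H)) (with_proj (strong_product G H))"
  then have "card (parcs (kronecker_product G H)) = card (parcs (strong_product G H))"
    by (auto dest: digraph_iso_card_arcs)
  moreover have "parcs (kronecker_product G H) \<subset> parcs (strong_product G H)"
    \<comment> \<open>The cardinality bound on \<open>H\<close> serves to give a vertex: the empty
      set has \<open>card\<close> 0.\<close>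
    using connected_imp_arcs_nonempty[OF assms(3,5)] H.no_loops assms(6)
    by (intro kronecker_product_arcs_psubset_strong_product) auto
  then have "card (parcs (kronecker_product G H)) < card (parcs (strong_product G H))"
    by (rule psubset_card_mono[OF S.pair_finite_arcs])
  ultimately show False by simp
qed

end
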